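(* Let $T=(V,E)$ be a (finite or infinite) combinatorial tree with at least two vertices, and let $f:V\to V$ be a function with finite range. Then either $f(v)=v$ for some vertex $v\in V$, or there is an edge $e\in E$ with endpoints $x$ and $y$ such that $e$ is on the path in $T$ from $f(x)$ to $f(y)$.
   Context: A tree $T=(V,E)$ is a connected acyclic graph with vertex set $V$ and edge set $E$; $V$ may be finite or infinite, and $V$ is assumed to have at least two vertices. Between any two vertices there is a unique (finite) path of edges. *)

theory Defs
  imports "Graph_Theory.Graph_Theory"
begin

text \<open>
  An undirected simple graph, finite or infinite, is rendered as a loop-free symmetric digraph
  without parallel arcs: the undirected edge with endpoints \<open>x\<close> and \<open>y\<close> is the pair of opposite
  arcs \<open>(x,y)\<close>, \<open>(y,x)\<close>.

  The predicates \<open>forest\<close> and \<open>tree\<close> of the AFP library are unsuitable for such graphs, since they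
  forbid (only) directed cycles, and \<open>[(x,y), (y,x)]\<close> is one. The cycles of the
  undirected graph are exactly the directed cycles of length at least 3.
\<close>

definition undirected_tree :: "'v pair_pre_digraph \<Rightarrow> bool" where
  "undirected_tree T \<longleftrightarrow>
     pair_bidirected_digraph T \<and>
     connected (with_proj T) \<and>
     \<not> (\<exists>p. pre_digraph.cycle (with_proj T) p \<and> 3 \<le> length p)"

text \<open>Meaningful for vertices \<open>u\<close>, \<open>v\<close> of a tree, where the path without repeated vertices exists
  and is unique.\<close>

definition tree_path :: "'v pair_pre_digraph \<Rightarrow> 'v \<Rightarrow> 'v \<Rightarrow> ('v \<times> 'v) list" where
  "tree_path T u v = (THE p. pre_digraph.apath (with_proj T) u p v)"

text \<open>A path may traverse an undirected edge in either direction.\<close>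

definition edge_on_path :: "'v \<Rightarrow> 'v \<Rightarrow> ('v \<times> 'v) list \<Rightarrow> bool" where
  "edge_on_path x y p \<longleftrightarrow> (x, y) \<in> set p \<or> (y, x) \<in> set p"

end

theory Submission
  imports Defs
begin

text \<open>
  In a tree, a walk that never turns back along the arc it has just used cannot return to a vertex
  it has already visited: the shortest return would close a cycle of length at least 3
  (\<open>non_backtracking_awalk_imp_apath\<close>). So non-backtracking walks are exactly the paths, and
  whenever two of them can be joined without turning back at the junction, the result is the
  unique path between its ends (\<open>apath_unique\<close>).

  Suppose that \<open>f\<close> fixes no vertex, and let \<open>g v\<close> be the second vertex of the path
  from \<open>v\<close> to \<open>f v\<close>.

  If \<open>g (g v) = v\<close> for some \<open>v\<close>, then \<open>v\<close> and \<open>g v\<close> are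
  the two ends of an edge whose ends are sent to opposite sides of it: the path from \<open>v\<close> to
  \<open>f v\<close> and the path from \<open>g v\<close> to \<open>f (g v)\<close> both begin by crossing the edge.
  Reversing the first and joining it to the second yields the path from \<open>f v\<close> to
  \<open>f (g v)\<close>, and it crosses the edge
  (\<open>opposite_first_arcs_on_tree_path\<close>).

  Otherwise the orbit \<open>r i = (g ^^ i) v\<close> of any vertex never turns back. Walking along it to
  \<open>r i\<close> and then on to \<open>f (r i)\<close> does not turn back either, because the second part
  starts with the arc to \<open>r (Suc i)\<close>. It is therefore the path from \<open>r 0\<close> to
  \<open>f (r i)\<close>, so that \<open>f (r i)\<close> is at distance more than \<open>i\<close> from
  \<open>r 0\<close> (\<open>long_tree_path_along_ray\<close>). As \<open>i\<close> is arbitrary, the range of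
  \<open>f\<close> is unbounded, which is impossible for a finite set.
\<close>

text \<open>In a walk each arc starts where the previous one ends, so there the condition says that no
  arc is followed by its opposite.\<close>

abbreviation non_backtracking :: "('v \<times> 'v) list \<Rightarrow> bool" where
  "non_backtracking \<equiv> successively (\<lambda>e e'. snd e' \<noteq> fst e)"

lemma rev_path_conv_rev_map: "rev_path p = rev (map prod.swap p)"
  by (induction p) auto

lemma non_backtracking_rev_path [simp]: "non_backtracking (rev_path p) \<longleftrightarrow> non_backtracking p"
  by (simp add: rev_path_conv_rev_map successively_map eq_commute)

text \<open>Non-backtracking is a condition on pairs of neighbours in the list, and every such pair lies
  in one of two lists that overlap in a single arc.\<close>

lemma non_backtracking_glue:
  assumes "non_backtracking (p @ [e])" and "non_backtracking (e # q)"
  shows "non_backtracking (p @ e # q)"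
  using assms by (auto simp: successively_append_iff)

text \<open>A pair of opposite arcs is a cycle of length 2, hence the bound 3.\<close>

locale undirected_tree_digraph = pair_bidirected_digraph +
  assumes connected: "connected (with_proj G)"
    and no_long_cycle: "cycle c \<Longrightarrow> length c < 3"

lemma undirected_tree_digraphI:
  assumes "undirected_tree T"
  shows "undirected_tree_digraph T"
proof -
  from assms interpret pair_bidirected_digraph T
    by (simp add: undirected_tree_def)
  show ?thesis
    using assms by unfold_locales (auto simp: undirected_tree_def not_le)
qed

text \<open>Turning back would revisit the start of the arc just used.\<close>

lemma (in pair_wf_digraph) apath_imp_non_backtracking:
  "apath u p v \<Longrightarrow> non_backtracking p"
proof (induction p arbitrary: u)
  case (Cons e p)
  then have "non_backtracking p" and "apath (snd e) p v" and "fst e \<notin> set (awalk_verts (snd e) p)"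
    by (auto simp: apath_Cons_iff)
  then show ?case
    by (cases p) (auto simp: apath_Cons_iff dest: hd_in_awalk_verts)
qed simp

context undirected_tree_digraph
begin

text \<open>
  By induction the walk after its first arc \<open>e\<close> is a path. If that path came back to the
  start of \<open>e\<close>, then \<open>e\<close> followed by its initial part would be a cycle. Acyclicity
  makes this cycle a loop or a pair of opposite arcs; the graph has no loops, and the pair would
  be a turn.
\<close>

lemma non_backtracking_awalk_imp_apath:
  assumes "awalk u p v" and "non_backtracking p"
  shows "apath u p v"
  using assms
proof (induction p arbitrary: u)
  case Nil
  then show ?case
    by (auto simp: awalk_Nil_iff apath_Nil_iff)
next
  case (Cons e p)
  from Cons.prems have e: "e \<in> parcs G" "u = fst e" and p: "awalk (snd e) p v"
    by (auto simp: awalk_Cons_iff)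
  from Cons have path: "apath (snd e) p v"
    by (auto simp: awalk_Cons_iff successively_Cons)
  have "u \<notin> set (awalk_verts (snd e) p)"
  proof
    assume "u \<in> set (awalk_verts (snd e) p)"
    then obtain q r where pqr: "p = q @ r" and q: "awalk (snd e) q u"
      using awalk_decomp[OF p] by blast
    from path q have "apath (snd e) q u"
      by (simp add: pqr apath_append_iff)
    then have "distinct (awalk_verts (snd e) q)"
      by (simp add: apath_def)
    with e q have "cycle (e # q)"
      by (auto simp: cycle_def awalk_Cons_iff)
    then have "length q < 2"
      using no_long_cycle[of "e # q"] by simp
    then consider "q = []" | e' where "q = [e']"
      by (cases q) auto
    then show False
    proof cases
      case 1
      with q e show False
        using no_loops[of e] by (auto simp: awalk_Nil_iff)
    next
      case 2
      with q have "snd e' = fst e"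
        using e by (auto simp: awalk_simps)
      with Cons.prems(2) show False
        by (simp add: pqr 2)
    qed
  qed
  with e path show ?case
    by (simp add: apath_Cons_iff)
qed

text \<open>
  Two paths that part at their first arcs can be joined, one of them reversed, without turning back
  at the common start. The result is a nonempty closed walk that does not turn back, contradicting
  that such walks are paths.
\<close>

lemma apath_unique:
  assumes "apath u p v" and "apath u q v"
  shows "p = q"
  using assms
proof (induction p arbitrary: u q)
  case Nil
  then show ?case
    using apath_nonempty_ends[of u q v] by (auto simp: apath_Nil_iff)
next
  case (Cons e p)
  have "q \<noteq> []"
    using Cons.prems apath_nonempty_ends[of u "e # p" v] by (auto simp: apath_Nil_iff)
  then obtain e' q' where q: "q = e' # q'"
    by (cases q) auto
  show ?case
  proof (cases "e = e'")
    case True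
    with Cons q show ?thesis
      by (auto simp: apath_Cons_iff)
  next
    case False
    from Cons.prems q have "fst e = fst e'"
      by (simp add: apath_Cons_iff)
    with False have "snd e' \<noteq> snd e"
      by (simp add: prod_eq_iff)
    moreover have "non_backtracking (rev_path (e # p))" and "non_backtracking q"
      using Cons.prems apath_imp_non_backtracking non_backtracking_rev_path by blast+
    ultimately have "non_backtracking (rev_path (e # p) @ q)"
      using q by (simp add: successively_append_iff)
    moreover have "awalk v (rev_path (e # p) @ q) v"
      using Cons.prems awalk_rev_path by (blast intro: awalk_appendI awalkI_apath)
    ultimately have "apath v (rev_path (e # p) @ q) v"
      by (intro non_backtracking_awalk_imp_apath)
    then show ?thesis
      using apath_nonempty_ends q by blast
  qed
qed

lemma tree_path_eq: "apath u p v \<Longrightarrow> tree_path G u v = p"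
  unfolding tree_path_def using apath_unique by blast

lemma apath_tree_path:
  assumes "u \<in> pverts G" and "v \<in> pverts G"
  shows "apath u (tree_path G u v) v"
proof -
  have "strongly_connected (with_proj G)"
    using sym_arcs connected by (rule symmetric_connected_imp_strongly_connected)
  then have "u \<rightarrow>\<^sup>*\<^bsub>with_proj G\<^esub> v"
    using assms by (auto simp: strongly_connected_def)
  then obtain p where "apath u p v"
    by (auto simp: reachable_apath)
  with tree_path_eq show ?thesis
    by blast
qed

text \<open>
  If the path from \<open>x\<close> to \<open>a\<close> and the path from \<open>y\<close> to \<open>b\<close>
  both start with the edge joining \<open>x\<close> and \<open>y\<close>, then this edge separates
  \<open>a\<close> from \<open>b\<close>. The path from \<open>a\<close> to \<open>b\<close> is obtained by
  overlapping the reverse of the former with the latter in their common arc \<open>(y, x)\<close>.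
\<close>

lemma opposite_first_arcs_on_tree_path:
  assumes "apath x ((x, y) # p) a" and "apath y ((y, x) # q) b"
  shows "(y, x) \<in> set (tree_path G a b)"
proof -
  have "non_backtracking (rev_path ((x, y) # p))"
    using apath_imp_non_backtracking[OF assms(1)] by (subst non_backtracking_rev_path)
  then have "non_backtracking (rev_path p @ [(y, x)])"
    by simp
  then have "non_backtracking (rev_path p @ (y, x) # q)"
    using apath_imp_non_backtracking[OF assms(2)] by (rule non_backtracking_glue)
  moreover have "awalk a (rev_path p) y"
    using assms(1) by (auto simp: apath_Cons_iff dest: awalkI_apath)
  then have "awalk a (rev_path p @ (y, x) # q) b"
    using awalkI_apath[OF assms(2)] by (rule awalk_appendI)
  ultimately have "tree_path G a b = rev_path p @ (y, x) # q"
    by (blast intro: tree_path_eq non_backtracking_awalk_imp_apath)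
  then show ?thesis
    by simp
qed

text \<open>
  The path from \<open>r i\<close> to \<open>w\<close> starts by continuing along the ray, so the piece of the
  ray from \<open>r 0\<close> to \<open>r i\<close> can be put in front of it without creating a turn.
\<close>

lemma long_tree_path_along_ray:
  fixes r :: "nat \<Rightarrow> 'a"
  assumes arc: "\<And>j. (r j, r (Suc j)) \<in> parcs G"
    and turn: "\<And>j. r (Suc (Suc j)) \<noteq> r j"
    and path: "apath (r i) ((r i, r (Suc i)) # p) w"
  shows "i < length (tree_path G (r 0) w)"
proof -
  define W where "W n = map (\<lambda>j. (r j, r (Suc j))) [0..<n]" for n
  have walk: "awalk (r 0) (W n) (r n)" for n
  proof (induction n)
    case 0
    then show ?case
      using arc[of 0] by (auto simp: W_def awalk_Nil_iff dest: in_arcsD1)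
  next
    case (Suc n)
    have "awalk (r n) [(r n, r (Suc n))] (r (Suc n))"
      using arc[of n] by (auto simp: awalk_simps dest: in_arcsD2)
    from awalk_appendI[OF Suc this] show ?case
      by (simp add: W_def)
  qed
  have W_0: "W 0 = []"
    by (simp add: W_def)
  have W_Suc: "W (Suc n) = W n @ [(r n, r (Suc n))]" for n
    by (simp add: W_def)
  have "non_backtracking (W n)" for n
  proof (induction n)
    case (Suc n)
    then show ?case
      by (cases n) (auto simp: W_0 W_Suc successively_append_iff turn)
  qed (simp add: W_0)
  then have "non_backtracking (W i @ [(r i, r (Suc i))])"
    by (metis W_Suc)
  then have "non_backtracking (W i @ (r i, r (Suc i)) # p)"
    using apath_imp_non_backtracking[OF path] by (rule non_backtracking_glue)
  moreover have "awalk (r 0) (W i @ (r i, r (Suc i)) # p) w"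
    using walk awalkI_apath[OF path] by (rule awalk_appendI)
  ultimately have "tree_path G (r 0) w = W i @ (r i, r (Suc i)) # p"
    by (blast intro: tree_path_eq non_backtracking_awalk_imp_apath)
  then show ?thesis
    by (simp add: W_def)
qed

end

theorem theorem2:
  fixes T :: "'v pair_pre_digraph" and f :: "'v \<Rightarrow> 'v"
  assumes "undirected_tree T"
    and "\<exists>u\<in>pverts T. \<exists>v\<in>pverts T. u \<noteq> v"
    and "f ` pverts T \<subseteq> pverts T"
    and "finite (f ` pverts T)"
  shows "(\<exists>v\<in>pverts T. f v = v) \<or>
         (\<exists>x y. (x, y) \<in> parcs T \<and> edge_on_path x y (tree_path T (f x) (f y)))"
proof (rule ccontr)
  assume contra: "\<not> ?thesis"
  interpret undirected_tree_digraph T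
    using assms(1) by (rule undirected_tree_digraphI)
  define g where "g v = snd (hd (tree_path T v (f v)))" for v
  have step: "\<exists>p. apath v ((v, g v) # p) (f v)" if "v \<in> pverts T" for v
  proof -
    have path: "apath v (tree_path T v (f v)) (f v)"
      using that assms(3) by (intro apath_tree_path) auto
    with contra that have "tree_path T v (f v) \<noteq> []"
      by (auto simp: apath_Nil_iff)
    with path show ?thesis
      unfolding g_def by (cases "tree_path T v (f v)") (auto simp: apath_Cons_iff)
  qed
  have arc: "(v, g v) \<in> parcs T" if "v \<in> pverts T" for v
    using step[OF that] by (auto simp: apath_Cons_iff)
  have turn: "g (g v) \<noteq> v" if v: "v \<in> pverts T" for v
  proof
    assume g_g: "g (g v) = v"
    obtain p where p: "apath v ((v, g v) # p) (f v)"
      using step[OF v] by blast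
    obtain q where q: "apath (g v) ((g v, v) # q) (f (g v))"
      using step[OF in_arcsD2[OF arc[OF v]]] g_g by auto
    from opposite_first_arcs_on_tree_path[OF p q]
    have "edge_on_path v (g v) (tree_path T (f v) (f (g v)))"
      by (simp add: edge_on_path_def)
    with contra arc[OF v] show False
      by blast
  qed
  obtain v where v: "v \<in> pverts T"
    using assms(2) by blast
  define r where "r i = (g ^^ i) v" for i
  have r_Suc: "r (Suc i) = g (r i)" for i
    by (simp add: r_def)
  have r_vert: "r i \<in> pverts T" for i
    by (induction i) (use v arc in \<open>auto simp: r_def dest: in_arcsD2\<close>)
  (* The index for which the path along the orbit is longer than every path from r 0 into the
     range of f. *)
  define L where "L = Max ((\<lambda>w. length (tree_path T (r 0) w)) ` f ` pverts T)"
  obtain p where "apath (r L) ((r L, r (Suc L)) # p) (f (r L))"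
    using step[OF r_vert] by (auto simp: r_Suc)
  then have "L < length (tree_path T (r 0) (f (r L)))"
    using arc turn r_vert by (intro long_tree_path_along_ray) (auto simp: r_Suc)
  moreover have "length (tree_path T (r 0) (f (r L))) \<le> L"
    unfolding L_def using assms(4) r_vert by (intro Max_ge) auto
  ultimately show False
    by simp
qed

end
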